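(* Consider the Gaussian $p$-factor model with $p\ge 2$, $$\boldsymbol{Z}_D=\boldsymbol{A}_D\boldsymbol{W}+\boldsymbol{\Psi}_D\boldsymbol{\epsilon}_D ,$$ where $\boldsymbol{Z}_D$ is the $D\times 1$ vector of observed variables, $\boldsymbol{A}_D$ is a $D\times p$ loading matrix, $\boldsymbol{W}$ is the $p\times 1$ vector of latent variables, $\boldsymbol{\Psi}_D$ is a $D\times D$ diagonal matrix and $\boldsymbol{\epsilon}_D$ is the $D\times1$ vector of disturbances. (a) If $\boldsymbol{A}_D$ does not have full column rank, then the latent variables in $\boldsymbol{W}$ are not identifiable. (b) For the Gaussian bi-factor model, as a special case of the $p$-factor model with $p=G+1$: if $\boldsymbol{A}_D$ does not have full column rank, then the Gaussian bi-factor model can be rewritten as an oblique factor model with fewer parameters.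
   Context: In the Gaussian $p$-factor model the components of $\boldsymbol{W}$ and of $\boldsymbol{\epsilon}_D$ are mutually independent $N(0,1)$ random variables and the observed variables are standardized to be $N(0,1)$. "The latent variables are not identifiable" means that $\boldsymbol{W}$ is not determined by the noise-free part $\boldsymbol{Z}_D-\boldsymbol{\Psi}_D\boldsymbol{\epsilon}_D=\boldsymbol{A}_D\boldsymbol{W}$; only some linear combinations of the latent variables can be identified. Gaussian bi-factor model with $G$ groups, $d_g$ variables in group $g$, $D=\sum_{g=1}^G d_g$: $$Z_{jg}=\alpha_{jg,0}W_0+\alpha_{jg}W_g+\psi_{jg}\epsilon_{jg},\quad j\in\{1,\dots,d_g\},\ g\in\{1,\dots,G\},$$ with $W_0,\{W_g\},\{\epsilon_{jg}\}$ mutually independent $N(0,1)$, $\alpha$'s in $(-1,1)$, and $\psi_{jg}^2=1-\alpha_{jg,0}^2-\alpha_{jg}^2$. Here $\boldsymbol{W}=(W_0,W_1,\dots,W_G)^T$; the first column of $\boldsymbol{A}_D$ contains the global loadings $\alpha_{jg,0}$, and the column corresponding to $W_g$ contains the local loadings $\alpha_{jg}$ in the rows of group $g$ and zeros elsewhere. Gaussian oblique factor model with $G$ groups: $$Z_{jg}=\alpha_{jg}W_g+\psi_{jg}\epsilon_{jg},\quad j\in\{1,\dots,d_g\},\ g\in\{1,\dots,G\},$$ where $\{\epsilon_{jg}\}$ are mutually independent $N(0,1)$, independent of the multivariate normal vector $(W_1,\dots,W_G)$ which has zero mean, unit variances and is allowed to have dependent components, and $\psi_{jg}^2=1-\alp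ha_{jg}^2$.
   Formalization: Part (b) additionally assumes that every group has a nonzero local loading (each W_g really occurs); if some local column is zero, the claim can fail. Parameters: 2D loadings versus D loadings plus one correlation parameter per group with at least two variables. *)

theory Defs
  imports "HOL-Analysis.Analysis" "HOL-Probability.Probability"
begin

definition std_normal_var :: "'a measure \<Rightarrow> ('a \<Rightarrow> real) \<Rightarrow> bool" where
  "std_normal_var M X \<longleftrightarrow> distributed M lborel X std_normal_density"

definition diag_matrix :: "('d::finite \<Rightarrow> real) \<Rightarrow> real ^ 'd ^ 'd" where
  "diag_matrix \<psi> = (\<chi> i j. if i = j then \<psi> i else 0)"

definition gaussian_factor_model ::
  "'a measure \<Rightarrow> real ^ 'p ^ 'd \<Rightarrow> real ^ 'd ^ 'd \<Rightarrow>
   ('a \<Rightarrow> real ^ 'd) \<Rightarrow> ('a \<Rightarrow> real ^ 'p) \<Rightarrow> ('a \<Rightarrow> real ^ 'd) \<Rightarrow> bool" where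
  "gaussian_factor_model M A \<Psi> Z W \<epsilon> \<longleftrightarrow>
     prob_space M \<and>
     prob_space.indep_vars M (\<lambda>_. borel)
       (case_sum (\<lambda>k \<omega>. W \<omega> $ k) (\<lambda>j \<omega>. \<epsilon> \<omega> $ j)) (UNIV :: ('p + 'd) set) \<and>
     (\<forall>k. std_normal_var M (\<lambda>\<omega>. W \<omega> $ k)) \<and>
     (\<forall>j. std_normal_var M (\<lambda>\<omega>. \<epsilon> \<omega> $ j)) \<and>
     (\<forall>j. std_normal_var M (\<lambda>\<omega>. Z \<omega> $ j)) \<and>
     (\<forall>i j. i \<noteq> j \<longrightarrow> \<Psi> $ i $ j = 0) \<and>
     (AE \<omega> in M. Z \<omega> = A *v W \<omega> + \<Psi> *v \<epsilon> \<omega>)"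

text \<open>\<open>X\<close> is determined by \<open>Y\<close> if it is almost surely a Borel function of \<open>Y\<close>. Measurability of
  the function matters: an arbitrary \<open>h\<close> could exist for pathological \<open>M\<close> (e.g. the trace of a
  Gaussian measure on a non-measurable set of full outer measure that meets every line of a
  given direction at most once).\<close>

definition determined_by ::
  "'a measure \<Rightarrow> ('a \<Rightarrow> 'b::topological_space) \<Rightarrow> ('a \<Rightarrow> 'c::topological_space) \<Rightarrow> bool" where
  "determined_by M X Y \<longleftrightarrow> (\<exists>h \<in> borel_measurable borel. AE \<omega> in M. X \<omega> = h (Y \<omega>))"

definition noise_free_part ::
  "real ^ 'd ^ 'd \<Rightarrow> ('a \<Rightarrow> real ^ 'd) \<Rightarrow> ('a \<Rightarrow> real ^ 'd) \<Rightarrow> 'a \<Rightarrow> real ^ 'd" where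
  "noise_free_part \<Psi> Z \<epsilon> = (\<lambda>\<omega>. Z \<omega> - \<Psi> *v \<epsilon> \<omega>)"

definition identified_combinations ::
  "'a measure \<Rightarrow> real ^ 'd ^ 'd \<Rightarrow>
   ('a \<Rightarrow> real ^ 'd) \<Rightarrow> ('a \<Rightarrow> real ^ 'p) \<Rightarrow> ('a \<Rightarrow> real ^ 'd) \<Rightarrow> (real ^ 'p) set" where
  "identified_combinations M \<Psi> Z W \<epsilon> =
     {c. determined_by M (\<lambda>\<omega>. c \<bullet> W \<omega>) (noise_free_part \<Psi> Z \<epsilon>)}"

text \<open>Grouped variables: the finite type \<open>'v\<close> indexes all observed variables, the pairs
  \<open>(j, g)\<close>, and \<open>grp :: 'v \<Rightarrow> 'g\<close> sends a variable to its group, so that \<open>D = CARD('v)\<close>,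
  \<open>G = CARD('g)\<close>, \<open>d\<^sub>g = card (grp -` {g})\<close>, and \<open>surj grp\<close> says that every \<open>d\<^sub>g\<close> is positive.
  The latent variables of the bi-factor model are indexed by \<open>'g option\<close>, which has \<open>G + 1\<close>
  elements: \<open>None\<close> is the global one and \<open>Some g\<close> the local one of group \<open>g\<close>.\<close>

definition bifactor_loadings ::
  "('v \<Rightarrow> 'g) \<Rightarrow> ('v \<Rightarrow> real) \<Rightarrow> ('v \<Rightarrow> real) \<Rightarrow> real ^ ('g::finite option) ^ ('v::finite)" where
  "bifactor_loadings grp \<alpha>0 \<alpha> =
     (\<chi> v k. case k of None \<Rightarrow> \<alpha>0 v | Some g \<Rightarrow> if grp v = g then \<alpha> v else 0)"

lemma bifactor_equation:
  fixes grp :: "'v::finite \<Rightarrow> 'g::finite"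
  shows "(bifactor_loadings grp \<alpha>0 \<alpha> *v w + diag_matrix \<psi> *v e) $ v =
           \<alpha>0 v * w $ None + \<alpha> v * w $ Some (grp v) + \<psi> v * e $ v"
proof -
  have "(bifactor_loadings grp \<alpha>0 \<alpha> *v w) $ v =
          \<alpha>0 v * w $ None + (\<Sum>g\<in>UNIV. (if grp v = g then \<alpha> v else 0) * w $ Some g)"
    by (simp add: bifactor_loadings_def matrix_vector_mult_def UNIV_option_conv sum.reindex)
  also have "(\<Sum>g\<in>UNIV. (if grp v = g then \<alpha> v else 0) * w $ Some g) = \<alpha> v * w $ Some (grp v)"
    by (simp add: if_distrib[of "\<lambda>x. x * _"] cong: if_cong)
  moreover have "(diag_matrix \<psi> *v e) $ v = \<psi> v * e $ v"
    by (simp add: diag_matrix_def matrix_vector_mult_def if_distrib[of "\<lambda>x. x * _"] cong: if_cong)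
  ultimately show ?thesis by simp
qed

definition gaussian_bifactor_model ::
  "'a measure \<Rightarrow> ('v \<Rightarrow> 'g) \<Rightarrow> ('v \<Rightarrow> real) \<Rightarrow> ('v \<Rightarrow> real) \<Rightarrow> ('v \<Rightarrow> real) \<Rightarrow>
   ('a \<Rightarrow> real ^ 'v) \<Rightarrow> ('a \<Rightarrow> real ^ ('g::finite option)) \<Rightarrow> ('a \<Rightarrow> real ^ ('v::finite)) \<Rightarrow> bool"
  where
  "gaussian_bifactor_model M grp \<alpha>0 \<alpha> \<psi> Z W \<epsilon> \<longleftrightarrow>
     surj grp \<and>
     (\<forall>v. -1 < \<alpha>0 v \<and> \<alpha>0 v < 1 \<and> -1 < \<alpha> v \<and> \<alpha> v < 1) \<and>
     (\<forall>v. (\<psi> v)\<^sup>2 = 1 - (\<alpha>0 v)\<^sup>2 - (\<alpha> v)\<^sup>2) \<and>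
     gaussian_factor_model M (bifactor_loadings grp \<alpha>0 \<alpha>) (diag_matrix \<psi>) Z W \<epsilon>"

text \<open>A random vector is multivariate normal if all its linear combinations are univariate normal,
  where a constant counts as normal with variance zero (the covariance matrix may be singular).\<close>

definition multivariate_normal :: "'a measure \<Rightarrow> ('a \<Rightarrow> real ^ 'n) \<Rightarrow> bool" where
  "multivariate_normal M X \<longleftrightarrow>
     X \<in> borel_measurable M \<and>
     (\<forall>c. \<exists>\<mu> \<sigma>. (\<sigma> = 0 \<and> (AE \<omega> in M. c \<bullet> X \<omega> = \<mu>)) \<or>
                (\<sigma> > 0 \<and> distributed M lborel (\<lambda>\<omega>. c \<bullet> X \<omega>) (normal_density \<mu> \<sigma>)))"

definition gaussian_oblique_model ::
  "'a measure \<Rightarrow> ('v \<Rightarrow> 'g) \<Rightarrow> ('v \<Rightarrow> real) \<Rightarrow> real ^ 'g ^ 'g \<Rightarrow> ('v \<Rightarrow> real) \<Rightarrow>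
   ('a \<Rightarrow> real ^ 'v) \<Rightarrow> ('a \<Rightarrow> real ^ ('g::finite)) \<Rightarrow> ('a \<Rightarrow> real ^ ('v::finite)) \<Rightarrow> bool" where
  "gaussian_oblique_model M grp \<alpha> R \<psi> Z W \<epsilon> \<longleftrightarrow>
     prob_space M \<and> surj grp \<and>
     multivariate_normal M W \<and>
     (\<forall>g. prob_space.expectation M (\<lambda>\<omega>. W \<omega> $ g) = 0) \<and>
     (\<forall>g. prob_space.variance M (\<lambda>\<omega>. W \<omega> $ g) = 1) \<and>
     (\<forall>g h. prob_space.expectation M (\<lambda>\<omega>. W \<omega> $ g * W \<omega> $ h) = R $ g $ h) \<and>
     prob_space.indep_vars M (\<lambda>_. borel) (\<lambda>v \<omega>. \<epsilon> \<omega> $ v) UNIV \<and>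
     (\<forall>v. std_normal_var M (\<lambda>\<omega>. \<epsilon> \<omega> $ v)) \<and>
     prob_space.indep_set M (sets (vimage_algebra (space M) W borel))
                            (sets (vimage_algebra (space M) \<epsilon> borel)) \<and>
     (\<forall>v. (\<psi> v)\<^sup>2 = 1 - (\<alpha> v)\<^sup>2) \<and>
     (AE \<omega> in M. \<forall>v. Z \<omega> $ v = \<alpha> v * W \<omega> $ grp v + \<psi> v * \<epsilon> \<omega> $ v)"

text \<open>Parameter counts. The \<open>\<psi>\<close>'s are functions of the loadings and are not counted. The
  bi-factor model has the \<open>2 D\<close> free parameters \<open>\<alpha>0 v\<close> (index \<open>Inl v\<close>) and \<open>\<alpha> v\<close>
  (index \<open>Inr v\<close>).

  The oblique models that arise from bi-factor models have latent correlations
  \<open>R g h = \<beta> g * \<beta> h\<close> for \<open>g \<noteq> h\<close>, because the new latent variables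
  \<open>(b g * W\<^sub>0 + W\<^sub>g) / sqrt (1 + (b g)\<^sup>2)\<close> depend on each other only through \<open>W\<^sub>0\<close>. For a group with
  a single variable the scale of the loading and that of \<open>\<beta> g\<close> are confounded, and \<open>\<beta> g\<close> is
  fixed to be 1. The free parameters are therefore the \<open>D\<close> loadings (index \<open>Inl v\<close>) and one
  \<open>\<beta> g\<close> (index \<open>Inr g\<close>) for each group with at least two variables.\<close>

definition bifactor_parameters :: "('v + 'v) set" where
  "bifactor_parameters = range Inl \<union> range Inr"

definition oblique_parameters :: "('v \<Rightarrow> 'g) \<Rightarrow> ('v + 'g) set" where
  "oblique_parameters grp = range Inl \<union> Inr ` {g. 2 \<le> card (grp -` {g})}"

definition oblique_correlations ::
  "('v \<Rightarrow> 'g) \<Rightarrow> ('v + 'g \<Rightarrow> real) \<Rightarrow> real ^ ('g::finite) ^ 'g" where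
  "oblique_correlations grp \<theta> =
     (let \<beta> = (\<lambda>g. if Inr g \<in> oblique_parameters grp then \<theta> (Inr g) else 1)
      in \<chi> g h. if g = h then 1 else \<beta> g * \<beta> h)"

end

theory Submission
  imports Defs
begin

text \<open>Part (a): let \<open>A *v c = 0\<close> with \<open>c \<noteq> 0\<close>, and suppose that \<open>c \<bullet> W = h (A *v W)\<close> almost surely.
  The density of \<open>W\<close> is positive, so \<open>c \<bullet> w = h (A *v w)\<close> for Lebesgue-almost every \<open>w\<close>.
  Translation by \<open>c\<close> preserves null sets and fixes the right-hand side but adds \<open>c \<bullet> c\<close> to the
  left-hand side, a contradiction.

  Part (b): a kernel vector has a nonzero global component because the local columns are nonzero
  and have disjoint supports. Hence the global loadings of a group are proportional to its local
  ones, and the two latent variables of a group can be merged into one.\<close>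

section \<open>Positivity of the joint density\<close>

text \<open>By Fubini for products of one-variable functions the two measures agree on boxes, and
  boxes determine a finite product of sigma-finite measures. \<open>sf\<close> ranges over all
  \<open>i\<close> because the product locale speaks of every index.\<close>

lemma (in product_sigma_finite) PiM_density:
  assumes [simp]: "finite I"
    and [measurable]: "\<And>i. i \<in> I \<Longrightarrow> f i \<in> borel_measurable (M i)"
    and sf: "\<And>i. sigma_finite_measure (density (M i) (f i))"
  shows "PiM I (\<lambda>i. density (M i) (f i)) = density (PiM I M) (\<lambda>x. \<Prod>i\<in>I. f i (x i))"
proof -
  interpret D: product_sigma_finite "\<lambda>i. density (M i) (f i)"
    using sf by (simp add: product_sigma_finite_def)
  show ?thesis
  proof (rule D.PiM_eqI[symmetric])
    show "sets (density (PiM I M) (\<lambda>x. \<Prod>i\<in>I. f i (x i))) = sets (PiM I (\<lambda>i. density (M i) (f i)))"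
      by (simp cong: sets_PiM_cong)
    fix A assume "\<And>i. i \<in> I \<Longrightarrow> A i \<in> sets (density (M i) (f i))"
    then have [measurable]: "\<And>i. i \<in> I \<Longrightarrow> A i \<in> sets (M i)" by simp
    have "emeasure (density (PiM I M) (\<lambda>x. \<Prod>i\<in>I. f i (x i))) (Pi\<^sub>E I A)
        = (\<integral>\<^sup>+x. (\<Prod>i\<in>I. f i (x i)) * indicator (Pi\<^sub>E I A) x \<partial>PiM I M)"
      by (subst emeasure_density) (auto intro!: sets_PiM_I_finite)
    also have "\<dots> = (\<integral>\<^sup>+x. (\<Prod>i\<in>I. f i (x i) * indicator (A i) (x i)) \<partial>PiM I M)"
    proof (rule nn_integral_cong)
      fix x assume "x \<in> space (PiM I M)"
      then have ext: "x \<in> extensional I" by (auto simp: space_PiM PiE_def)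
      \<comment> \<open>\<open>Pi\<^sub>E\<close> also constrains values outside \<open>I\<close>.
        Extensionality of \<open>x\<close> settles those, so leaving the box means leaving some
        \<open>A i\<close>.\<close>
      have "indicator (Pi\<^sub>E I A) x = (\<Prod>i\<in>I. indicator (A i) (x i) :: ennreal)"
      proof (cases "x \<in> Pi\<^sub>E I A")
        case True then show ?thesis by (auto simp: indicator_def PiE_iff)
      next
        case False
        then obtain i where "i \<in> I" "x i \<notin> A i" using ext by (auto simp: PiE_iff)
        then have "(\<Prod>i\<in>I. indicator (A i) (x i) :: ennreal) = 0"
          by (intro prod_zero) (auto intro!: bexI[of _ i])
        with False show ?thesis by simp
      qed
      then show "(\<Prod>i\<in>I. f i (x i)) * indicator (Pi\<^sub>E I A) x = (\<Prod>i\<in>I. f i (x i) * indicator (A i) (x i))"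
        by (simp add: prod.distrib)
    qed
    also have "\<dots> = (\<Prod>i\<in>I. \<integral>\<^sup>+x. f i x * indicator (A i) x \<partial>M i)"
      by (rule product_nn_integral_prod) auto
    also have "\<dots> = (\<Prod>i\<in>I. emeasure (density (M i) (f i)) (A i))"
      by (intro prod.cong) (auto simp: emeasure_density)
    finally show "emeasure (density (PiM I M) (\<lambda>x. \<Prod>i\<in>I. f i (x i))) (Pi\<^sub>E I A)
      = (\<Prod>i\<in>I. emeasure (density (M i) (f i)) (A i))" .
  qed simp
qed

text \<open>Injectivity makes the blocks \<open>{f j}\<close> disjoint. Disjoint blocks of an
  independent family are independent, and projecting each block to its only coordinate preserves
  this.\<close>

lemma (in prob_space) indep_vars_reindex:
  assumes "indep_vars M' X I" "inj_on f J" "f ` J \<subseteq> I"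
  shows "indep_vars (M' \<circ> f) (X \<circ> f) J"
proof -
  have "indep_vars (\<lambda>j. PiM {f j} M') (\<lambda>j \<omega>. restrict (\<lambda>i. X i \<omega>) {f j}) J"
    using assms by (intro indep_vars_restrict[OF assms(1)])
      (auto simp: disjoint_family_on_def inj_on_def)
  then have "indep_vars (M' \<circ> f) (\<lambda>j \<omega>. (\<lambda>x. x (f j)) (restrict (\<lambda>i. X i \<omega>) {f j})) J"
    by (rule indep_vars_compose2) (auto intro!: measurable_component_singleton)
  then show ?thesis by (simp add: comp_def)
qed

lemma borel_measurable_vec_nth_iff:
  fixes f :: "'a \<Rightarrow> real ^ 'n"
  shows "f \<in> borel_measurable M \<longleftrightarrow> (\<forall>i. (\<lambda>x. f x $ i) \<in> borel_measurable M)"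
  by (subst borel_measurable_euclidean_space) (auto simp: Basis_vec_def inner_axis)

text \<open>The strictly positive joint density makes Lebesgue measure absolutely continuous with
  respect to the law of \<open>W\<close>.\<close>

lemma (in prob_space) AE_lborel_of_std_normal_vector:
  fixes W :: "'a \<Rightarrow> real ^ 'p"
  assumes ind: "indep_vars (\<lambda>_. borel) (\<lambda>k \<omega>. W \<omega> $ k) UNIV"
    and std: "\<And>k. std_normal_var M (\<lambda>\<omega>. W \<omega> $ k)"
    and P[measurable]: "Measurable.pred borel P"
    and AE: "AE \<omega> in M. P (W \<omega>)"
  shows "AE w in lborel. P w"
proof -
  \<comment> \<open>\<open>lborel\<close> on vectors is the image of a product over
    \<open>Basis\<close>, so coordinates are reindexed by basis vectors; \<open>ix\<close> inverts
    \<open>axis i 1\<close>.\<close>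
  define ix :: "real ^ 'p \<Rightarrow> 'p" where "ix b = (THE i. b = axis i 1)" for b
  have ix: "ix (axis i 1) = i" for i by (simp add: ix_def axis_eq_axis)
  let ?X = "\<lambda>b \<omega>. W \<omega> $ ix b" and ?B = "Basis :: (real ^ 'p) set"
  let ?s = "\<lambda>f. \<Sum>b\<in>?B. f b *\<^sub>R b"
  have "inj_on ix ?B" by (auto simp: inj_on_def Basis_vec_def ix)
  from indep_vars_reindex[OF ind this]
  have ind': "indep_vars (\<lambda>_. borel) ?X ?B" by (simp add: comp_def)
  have meas: "?X b \<in> borel_measurable M" for b
    using std[of "ix b"] by (auto simp: std_normal_var_def distributed_def)
  have law: "distr M borel (?X b) = density lborel std_normal_density" for b
    using std[of "ix b"] unfolding std_normal_var_def
    by (subst distributed_distr_eq_density[symmetric]) (auto intro!: distr_cong)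
  interpret product_sigma_finite "\<lambda>b::real^'p. lborel :: real measure"
    by (simp add: product_sigma_finite_def sigma_finite_lborel)
  have "distr M (PiM ?B (\<lambda>_. borel)) (\<lambda>\<omega>. \<lambda>b\<in>?B. ?X b \<omega>) = PiM ?B (\<lambda>b. density lborel std_normal_density)"
    using ind' meas by (subst (asm) indep_vars_iff_distr_eq_PiM) (auto simp: law)
  also have "\<dots> = density (PiM ?B (\<lambda>_. lborel)) (\<lambda>x. \<Prod>b\<in>?B. ennreal (std_normal_density (x b)))"
    by (rule PiM_density)
      (auto intro!: prob_space_imp_sigma_finite prob_space_normal_density)
  finally have joint: "distr M (PiM ?B (\<lambda>_. borel)) (\<lambda>\<omega>. \<lambda>b\<in>?B. ?X b \<omega>)
    = density (PiM ?B (\<lambda>_. lborel)) (\<lambda>x. \<Prod>b\<in>?B. ennreal (std_normal_density (x b)))" .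
  have s: "?s (\<lambda>b. ?X b \<omega>) = W \<omega>" for \<omega>
  proof -
    have "?s (\<lambda>b. ?X b \<omega>) = (\<Sum>b\<in>?B. (W \<omega> \<bullet> b) *\<^sub>R b)"
      by (intro sum.cong) (auto simp: Basis_vec_def ix inner_axis)
    then show ?thesis by (simp add: euclidean_representation)
  qed
  have [measurable]: "?s \<in> borel_measurable (PiM ?B (\<lambda>_. borel))"
    by measurable
  have "AE f in distr M (PiM ?B (\<lambda>_. borel)) (\<lambda>\<omega>. \<lambda>b\<in>?B. ?X b \<omega>). P (?s f)"
    using AE meas by (subst AE_distr_iff) (auto simp: s intro!: measurable_restrict)
  then have "AE f in density (PiM ?B (\<lambda>_. lborel)) (\<lambda>x. \<Prod>b\<in>?B. ennreal (std_normal_density (x b))). P (?s f)"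
    by (simp only: joint)
  then have "AE f in PiM ?B (\<lambda>_. lborel). P (?s f)"
    by (subst (asm) AE_density) (auto simp: prod_ennreal prod_pos normal_density_pos)
  then have "AE w in distr (PiM ?B (\<lambda>_. lborel)) borel ?s. P w"
    by (subst AE_distr_iff) auto
  then show ?thesis by (subst lborel_eq)
qed

section \<open>Combinations along the kernel of the loading matrix\<close>

lemma (in prob_space) kernel_combination_not_determined:
  fixes W :: "'a \<Rightarrow> real ^ 'p" and A :: "real ^ 'p ^ 'd"
  assumes ind: "indep_vars (\<lambda>_. borel) (\<lambda>k \<omega>. W \<omega> $ k) UNIV"
    and std: "\<And>k. std_normal_var M (\<lambda>\<omega>. W \<omega> $ k)"
    and c: "c \<noteq> 0" "A *v c = 0"
    and Y: "AE \<omega> in M. Y \<omega> = A *v W \<omega>"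
  shows "\<not> determined_by M (\<lambda>\<omega>. c \<bullet> W \<omega>) Y"
proof
  assume "determined_by M (\<lambda>\<omega>. c \<bullet> W \<omega>) Y"
  then obtain h where h[measurable]: "h \<in> borel_measurable borel"
    and ae: "AE \<omega> in M. c \<bullet> W \<omega> = h (Y \<omega>)"
    unfolding determined_by_def by auto
  have [measurable]: "(\<lambda>w. A *v w) \<in> borel_measurable borel"
    by (intro borel_measurable_continuous_onI linear_continuous_on
        matrix_vector_mul_bounded_linear)
  \<comment> \<open>This predicate is Borel because \<open>h\<close> is, which allows its transfer
    from the law of \<open>W\<close> to Lebesgue measure.\<close>
  let ?P = "\<lambda>w. c \<bullet> w = h (A *v w)"
  have "AE w in lborel. ?P w"
    by (rule AE_lborel_of_std_normal_vector[OF ind std]) (use ae Y in auto)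
  moreover from this have "AE w in distr lborel borel ((+) c). ?P w"
    by (subst lborel_distr_plus)
  then have "AE w in lborel. ?P (c + w)"
    by (subst (asm) AE_distr_iff) auto
  ultimately have "AE w::real^'p in lborel. c \<bullet> c = 0"
  proof eventually_elim
    case (elim w)
    then show ?case by (simp add: matrix_vector_right_distrib inner_add_right c)
  qed
  then have "AE w::real^'p in lborel. False"
    using c by simp
  then have "emeasure lborel (UNIV :: (real^'p) set) = 0"
    by (simp add: AE_iff_measurable[OF _ refl])
  then show False by simp
qed

section \<open>Linear combinations of independent standard normal variables\<close>

text \<open>The intended family pools all latent variables and disturbances of a bi-factor model.
  New latent variables and new disturbances are then linear combinations of it, and their laws,
  covariances and independence can be read off the coefficients.\<close>

locale std_normal_family = prob_space M for M :: "'a measure" +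
  fixes F :: "'k::finite \<Rightarrow> 'a \<Rightarrow> real"
  assumes indep: "indep_vars (\<lambda>_. borel) F UNIV"
    and std: "std_normal_var M (F k)"
begin

definition comb :: "('k \<Rightarrow> real) \<Rightarrow> 'a \<Rightarrow> real" where
  "comb a \<omega> = (\<Sum>i\<in>UNIV. a i * F i \<omega>)"

lemma measurable_F [measurable]: "F k \<in> borel_measurable M"
  using std[of k] by (auto simp: std_normal_var_def distributed_def)

lemma measurable_comb [measurable]: "comb a \<in> borel_measurable M"
  unfolding comb_def[abs_def] by measurable

section \<open>First and second moments\<close>

lemma integrable_F: "integrable M (F i)"
  using distributed_integrable_var[OF std[of i, unfolded std_normal_var_def]]
    integrable_std_normal_moment[of 1] by simp

lemma expectation_F_mult:
  "integrable M (\<lambda>\<omega>. F i \<omega> * F j \<omega>)" "expectation (\<lambda>\<omega>. F i \<omega> * F j \<omega>) = (if i = j then 1 else 0)"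
proof -
  note D = std[unfolded std_normal_var_def]
  have "integrable M (\<lambda>\<omega>. F i \<omega> * F j \<omega>) \<and>
      expectation (\<lambda>\<omega>. F i \<omega> * F j \<omega>) = (if i = j then 1 else 0)"
  proof (cases "i = j")
    case True
    have "integrable M (\<lambda>\<omega>. (F i \<omega>)\<^sup>2)"
      using distributed_integrable[OF D[of i], of "\<lambda>x. x\<^sup>2"] integrable_std_normal_moment[of 2] by simp
    moreover have "expectation (\<lambda>\<omega>. (F i \<omega>)\<^sup>2) = 1"
      using standard_normal_distributed_variance[OF D[of i]]
      by (simp add: standard_normal_distributed_expectation[OF D])
    ultimately show ?thesis using True by (simp add: power2_eq_square)
  next
    case False
    have "indep_var borel ((\<lambda>x. x i) \<circ> (\<lambda>\<omega>. restrict (\<lambda>k. F k \<omega>) {i}))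
        borel ((\<lambda>x. x j) \<circ> (\<lambda>\<omega>. restrict (\<lambda>k. F k \<omega>) {j}))"
      by (rule indep_var_compose[OF indep_var_restrict[OF indep]]) (use False in auto)
    then have "indep_var borel (F i) borel (F j)" by (simp add: comp_def)
    from indep_var_integrable[OF this integrable_F integrable_F]
      indep_var_lebesgue_integral[OF this integrable_F integrable_F]
    show ?thesis using False by (simp add: standard_normal_distributed_expectation[OF D])
  qed
  then show "integrable M (\<lambda>\<omega>. F i \<omega> * F j \<omega>)"
    "expectation (\<lambda>\<omega>. F i \<omega> * F j \<omega>) = (if i = j then 1 else 0)" by auto
qed

lemma expectation_comb: "expectation (comb a) = 0"
  using integrable_F standard_normal_distributed_expectation[OF std[unfolded std_normal_var_def]]
  by (simp add: comb_def[abs_def])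

text \<open>Independence, zero means and unit variances make the \<open>F i\<close> orthonormal in
  L2, so \<open>comb\<close> preserves inner products.\<close>

lemma expectation_comb_mult: "expectation (\<lambda>\<omega>. comb a \<omega> * comb b \<omega>) = (\<Sum>i\<in>UNIV. a i * b i)"
proof -
  have "expectation (\<lambda>\<omega>. comb a \<omega> * comb b \<omega>)
      = expectation (\<lambda>\<omega>. \<Sum>i\<in>UNIV. \<Sum>j\<in>UNIV. (a i * b j) * (F i \<omega> * F j \<omega>))"
    by (simp add: comb_def sum_product mult_ac)
  also have "\<dots> = (\<Sum>i\<in>UNIV. \<Sum>j\<in>UNIV. (a i * b j) * expectation (\<lambda>\<omega>. F i \<omega> * F j \<omega>))"
    by (simp add: expectation_F_mult(1))
  also have "\<dots> = (\<Sum>i\<in>UNIV. a i * b i)"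
    by (simp add: expectation_F_mult(2) if_distrib[of "\<lambda>x. _ * x"] cong: if_cong)
  finally show ?thesis .
qed

section \<open>Normal laws of linear combinations\<close>

lemma distributed_comb:
  assumes "\<exists>i. a i \<noteq> 0"
  shows "distributed M lborel (comb a) (normal_density 0 (sqrt (\<Sum>i\<in>UNIV. (a i)\<^sup>2)))"
proof -
  \<comment> \<open>Terms with coefficient zero are constants without a normal density, so they are
    dropped before normal laws are added.\<close>
  let ?I = "{i. a i \<noteq> 0}"
  have "distributed M lborel (\<lambda>\<omega>. \<Sum>i\<in>?I. a i * F i \<omega>)
      (normal_density (\<Sum>i\<in>?I. 0) (sqrt (\<Sum>i\<in>?I. \<bar>a i\<bar>\<^sup>2)))"
  proof (rule sum_indep_normal)
    show "indep_vars (\<lambda>i. borel) (\<lambda>i \<omega>. a i * F i \<omega>) ?I"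
      by (rule indep_vars_compose2[OF indep_vars_subset[OF indep]]) auto
    fix i assume "i \<in> ?I"
    then show "distributed M lborel (\<lambda>\<omega>. a i * F i \<omega>) (normal_density 0 \<bar>a i\<bar>)"
      using normal_density_affine[OF std[of i, unfolded std_normal_var_def], of "a i" 0] by simp
  qed (use assms in auto)
  moreover have "(\<Sum>i\<in>?I. a i * F i \<omega>) = comb a \<omega>" for \<omega>
    unfolding comb_def by (rule sum.mono_neutral_left) auto
  moreover have "(\<Sum>i\<in>?I. (a i)\<^sup>2) = (\<Sum>i\<in>UNIV. (a i)\<^sup>2)"
    by (rule sum.mono_neutral_left) auto
  ultimately show ?thesis by simp
qed

lemma std_normal_comb:
  assumes "(\<Sum>i\<in>UNIV. (a i)\<^sup>2) = 1"
  shows "std_normal_var M (comb a)"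
proof -
  have "\<exists>i. a i \<noteq> 0" using assms by (metis (mono_tags) power_zero_numeral sum.neutral zero_neq_one)
  from distributed_comb[OF this] assms show ?thesis by (simp add: std_normal_var_def)
qed

lemma measurable_comb_vec [measurable]: "(\<lambda>\<omega>. \<chi> g. comb (B g) \<omega>) \<in> borel_measurable M"
  by (simp add: borel_measurable_vec_nth_iff)

lemma multivariate_normal_comb:
  fixes B :: "'n::finite \<Rightarrow> 'k \<Rightarrow> real"
  shows "multivariate_normal M (\<lambda>\<omega>. \<chi> g. comb (B g) \<omega>)"
  unfolding multivariate_normal_def
proof (intro conjI allI)
  fix c :: "real ^ 'n"
  define a where "a i = (\<Sum>g\<in>UNIV. c $ g * B g i)" for i
  have eq: "c \<bullet> (\<chi> g. comb (B g) \<omega>) = comb a \<omega>" for \<omega>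
    unfolding comb_def a_def inner_vec_def
    by (simp add: sum_distrib_left sum_distrib_right mult.assoc) (rule sum.swap)
  show "\<exists>\<mu> \<sigma>. (\<sigma> = 0 \<and> (AE \<omega> in M. c \<bullet> (\<chi> g. comb (B g) \<omega>) = \<mu>)) \<or>
        (\<sigma> > 0 \<and> distributed M lborel (\<lambda>\<omega>. c \<bullet> (\<chi> g. comb (B g) \<omega>)) (normal_density \<mu> \<sigma>))"
  \<comment> \<open>All \<open>a i\<close> can vanish although \<open>c\<close> is nonzero, for
    instance when two components of the vector coincide; this is the degenerate normal case.\<close>
  proof (cases "\<exists>i. a i \<noteq> 0")
    case True
    then have "0 < (\<Sum>i\<in>UNIV. (a i)\<^sup>2)"
      by (auto simp: sum_nonneg_eq_0_iff less_le sum_nonneg)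
    then have "0 < sqrt (\<Sum>i\<in>UNIV. (a i)\<^sup>2)" by simp
    with distributed_comb[OF True] show ?thesis unfolding eq by blast
  next
    case False
    then have "comb a \<omega> = 0" for \<omega> by (simp add: comb_def)
    then show ?thesis unfolding eq by auto
  qed
qed measurable

section \<open>Independence from disjoint coefficient supports\<close>

lemma comb_restrict:
  assumes "\<And>i. a i \<noteq> 0 \<Longrightarrow> i \<in> K"
  shows "comb a \<omega> = (\<Sum>i\<in>K. a i * restrict (\<lambda>i. F i \<omega>) K i)"
proof -
  have "(\<Sum>i\<in>K. a i * restrict (\<lambda>i. F i \<omega>) K i) = (\<Sum>i\<in>K. a i * F i \<omega>)" by simp
  also have "\<dots> = comb a \<omega>"
    unfolding comb_def by (rule sum.mono_neutral_left) (use assms in auto)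
  finally show ?thesis ..
qed

text \<open>Each combination is a measurable function of the block of \<open>F\<close> on its own
  support, and these blocks are disjoint.\<close>

lemma indep_vars_comb:
  assumes "\<And>u v i. a u i \<noteq> 0 \<Longrightarrow> a v i \<noteq> 0 \<Longrightarrow> u = v"
  shows "indep_vars (\<lambda>_. borel) (\<lambda>v. comb (a v)) J"
proof -
  let ?K = "\<lambda>v. {i. a v i \<noteq> 0}"
  have "indep_vars (\<lambda>v. PiM (?K v) (\<lambda>_. borel)) (\<lambda>v \<omega>. restrict (\<lambda>i. F i \<omega>) (?K v)) J"
    by (rule indep_vars_restrict[OF indep]) (use assms in \<open>auto simp: disjoint_family_on_def\<close>)
  then have "indep_vars (\<lambda>_. borel)
      (\<lambda>v \<omega>. (\<lambda>x. \<Sum>i\<in>?K v. a v i * x i) (restrict (\<lambda>i. F i \<omega>) (?K v))) J"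
    by (rule indep_vars_compose2) measurable
  moreover have "(\<lambda>\<omega>. \<Sum>i\<in>?K v. a v i * restrict (\<lambda>i. F i \<omega>) (?K v) i) = comb (a v)" for v
    by (rule ext, rule comb_restrict[symmetric]) simp
  ultimately show ?thesis by (simp only:)
qed

text \<open>With \<open>K\<close> the union of the supports of all \<open>B g\<close>, the first
  vector is a function of \<open>F\<close> on \<open>K\<close> and the second of \<open>F\<close> on
  the complement. The generated sigma-algebras lie inside those of the two independent
  blocks.\<close>

lemma indep_set_comb_vec:
  assumes "\<And>g v i. B g i \<noteq> 0 \<Longrightarrow> C v i = 0"
  shows "indep_set (sets (vimage_algebra (space M) (\<lambda>\<omega>. \<chi> g. comb (B g) \<omega>) borel))
    (sets (vimage_algebra (space M) (\<lambda>\<omega>. \<chi> v. comb (C v) \<omega>) borel))"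
proof -
  define K where "K = {i. \<exists>g. B g i \<noteq> 0}"
  let ?P = "\<lambda>K. PiM K (\<lambda>_. borel) :: ('k \<Rightarrow> real) measure"
  let ?R = "\<lambda>K \<omega>. restrict (\<lambda>i. F i \<omega>) K"
  let ?S = "\<lambda>K. vimage_algebra (space M) (?R K) (?P K)"
  have sub: "sets (vimage_algebra (space M) (\<lambda>\<omega>. \<chi> g. comb (A g) \<omega>) borel) \<subseteq> sets (?S K)"
    if AK: "\<And>g i. A g i \<noteq> 0 \<Longrightarrow> i \<in> K" for A :: "'n::finite \<Rightarrow> 'k \<Rightarrow> real" and K
  proof (rule sets_image_in_sets)
    have R: "?R K \<in> ?S K \<rightarrow>\<^sub>M ?P K"
      by (rule measurable_vimage_algebra1) (auto simp: space_PiM)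
    have "(\<lambda>x. \<chi> g. \<Sum>i\<in>K. A g i * x i) \<in> borel_measurable (?P K)"
      by (simp add: borel_measurable_vec_nth_iff)
    from measurable_compose[OF R this]
    show "(\<lambda>\<omega>. \<chi> g. comb (A g) \<omega>) \<in> borel_measurable (?S K)"
      by (simp add: comb_restrict[OF AK])
  qed simp
  have "indep_var (?P K) (?R K) (?P (-K)) (?R (-K))"
    by (rule indep_var_restrict[OF indep]) auto
  then have "indep_set (sets (?S K)) (sets (?S (-K)))"
    by (simp add: indep_var_eq sets_vimage_algebra)
  then show ?thesis
    unfolding indep_set_def
    by (rule indep_sets_mono_sets)
      (use sub[of B K] sub[of C "-K"] assms in \<open>auto simp: K_def split: bool.split\<close>)
qed

end

section \<open>The bi-factor model\<close>

text \<open>The groups that contribute a \<beta> are disjoint and contain at least two variables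
  each, so their number is at most D/2. This is strictly less than D because there is at least one
  variable.\<close>

lemma card_oblique_parameters_less:
  fixes grp :: "'v::finite \<Rightarrow> 'g::finite"
  shows "card (oblique_parameters grp) < card (bifactor_parameters :: ('v + 'v) set)"
proof -
  let ?S = "{g. 2 \<le> card (grp -` {g})}"
  have "2 * card ?S = (\<Sum>g\<in>?S. 2)" by simp
  also have "\<dots> \<le> (\<Sum>g\<in>?S. card (grp -` {g}))" by (rule sum_mono) simp
  also have "\<dots> = card (\<Union>g\<in>?S. grp -` {g})" by (subst card_UN_disjoint) auto
  also have "\<dots> \<le> CARD('v)" by (rule card_mono) auto
  finally have "card ?S < CARD('v)" using zero_less_card_finite[where 'a='v] by linarith
  moreover have "card (oblique_parameters grp) \<le> CARD('v) + card ?S"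
    unfolding oblique_parameters_def
    by (rule order_trans[OF card_Un_le]) (simp add: card_image)
  moreover have "card (bifactor_parameters :: ('v + 'v) set) = CARD('v) + CARD('v)"
    unfolding bifactor_parameters_def by (subst card_Un_disjoint) (auto simp: card_image)
  ultimately show ?thesis by linarith
qed

lemma sum_UNIV_option_sum:
  fixes f :: "'g::finite option + 'v::finite \<Rightarrow> real"
  shows "(\<Sum>i\<in>UNIV. f i) = f (Inl None) + (\<Sum>g\<in>UNIV. f (Inl (Some g))) + (\<Sum>v\<in>UNIV. f (Inr v))"
proof -
  have "(\<Sum>i\<in>UNIV. f i) = (\<Sum>k\<in>UNIV. f (Inl k)) + (\<Sum>v\<in>UNIV. f (Inr v))"
    by (simp add: UNIV_Plus_UNIV[symmetric] sum.Plus del: UNIV_Plus_UNIV)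
  then show ?thesis by (simp add: UNIV_option_conv sum.reindex)
qed

section \<open>Proportional loadings from rank deficiency\<close>

lemma rank_deficient_bifactor_loadings:
  fixes grp :: "'v::finite \<Rightarrow> 'g::finite"
  assumes col: "\<And>g. column (Some g) (bifactor_loadings grp \<alpha>0 \<alpha>) \<noteq> 0"
    and rank: "rank (bifactor_loadings grp \<alpha>0 \<alpha>) \<noteq> CARD('g option)"
  obtains b where "\<And>v. \<alpha>0 v = b (grp v) * \<alpha> v"
proof -
  obtain c where c: "c \<noteq> 0" "bifactor_loadings grp \<alpha>0 \<alpha> *v c = 0"
    using rank matrix_nonfull_linear_equations_eq by blast
  \<comment> \<open>The model equation with zero noise gives the kernel equation row by row.\<close>
  have eq: "\<alpha>0 v * c $ None + \<alpha> v * c $ Some (grp v) = 0" for v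
    using bifactor_equation[of grp \<alpha>0 \<alpha> c "\<lambda>_. 0" 0 v] c(2) by simp
  have c0: "c $ None \<noteq> 0"
  proof
    assume c0: "c $ None = 0"
    have "c $ Some g = 0" for g
    proof -
      obtain v where "bifactor_loadings grp \<alpha>0 \<alpha> $ v $ Some g \<noteq> 0"
        using col[of g] by (auto simp: column_def vec_eq_iff)
      then have "grp v = g" "\<alpha> v \<noteq> 0" by (auto simp: bifactor_loadings_def split: if_splits)
      with eq[of v] c0 show ?thesis by simp
    qed
    with c0 have "c $ k = 0" for k by (cases k) auto
    with c(1) show False by (simp add: vec_eq_iff)
  qed
  \<comment> \<open>Solving the row equation for \<open>\<alpha>0 v\<close> gives a factor that
    depends on \<open>v\<close> only through its group.\<close>
  show thesis
  proof
    fix v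
    show "\<alpha>0 v = (- c $ Some (grp v) / c $ None) * \<alpha> v"
      using eq[of v] c0 by (simp add: field_simps)
  qed
qed

text \<open>In a group with at least two variables the latent variable becomes
  \<open>(b g * W\<^sub>0 + W\<^sub>g) / sqrt (1 + (b g)\<^sup>2)\<close>. For a group with a single variable the correlation
  parameter is fixed to be 1, which forces the latent variable to be \<open>W\<^sub>0\<close>; then \<open>W\<^sub>g\<close> occurs in
  one equation only and is absorbed by the disturbance.\<close>

lemma bifactor_imp_oblique:
  fixes grp :: "'v::finite \<Rightarrow> 'g::finite"
  assumes model: "gaussian_bifactor_model M grp \<alpha>0 \<alpha> \<psi> Y V \<eta>"
    and b: "\<And>v. \<alpha>0 v = b (grp v) * \<alpha> v"
  shows "\<exists>(\<theta> :: 'v + 'g \<Rightarrow> real) \<psi>' V' \<eta>'.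
    gaussian_oblique_model M grp (\<lambda>v. \<theta> (Inl v)) (oblique_correlations grp \<theta>) \<psi>' Y V' \<eta>'"
proof -
  define F where "F = (case_sum (\<lambda>k \<omega>. V \<omega> $ k) (\<lambda>j \<omega>. \<eta> \<omega> $ j) :: 'g option + 'v \<Rightarrow> _)"
  from model have surj: "surj grp" and range: "\<bar>\<alpha>0 v\<bar> < 1"
    and psi: "(\<psi> v)\<^sup>2 = 1 - (\<alpha>0 v)\<^sup>2 - (\<alpha> v)\<^sup>2"
    and gm: "gaussian_factor_model M (bifactor_loadings grp \<alpha>0 \<alpha>) (diag_matrix \<psi>) Y V \<eta>" for v
    by (auto simp: gaussian_bifactor_model_def abs_less_iff minus_less_iff)
  have "prob_space M" "prob_space.indep_vars M (\<lambda>_. borel) F UNIV"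
    "std_normal_var M (F k)" for k
    using gm by (auto simp: gaussian_factor_model_def F_def split: sum.split)
  then interpret std_normal_family M F
    by (simp add: std_normal_family_def std_normal_family_axioms_def)
  have Y: "AE \<omega> in M. \<forall>v. Y \<omega> $ v = \<alpha>0 v * F (Inl None) \<omega> + \<alpha> v * F (Inl (Some (grp v))) \<omega> + \<psi> v * F (Inr v) \<omega>"
  proof -
    have "AE \<omega> in M. Y \<omega> = bifactor_loadings grp \<alpha>0 \<alpha> *v V \<omega> + diag_matrix \<psi> *v \<eta> \<omega>"
      using gm by (simp add: gaussian_factor_model_def)
    then show ?thesis by eventually_elim (simp only: bifactor_equation F_def sum.case simp_thms)
  qed

  define big where "big g \<longleftrightarrow> 2 \<le> card (grp -` {g})" for g
  define s where "s g = sqrt (1 + (b g)\<^sup>2)" for g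
  have s: "s g > 0" "(s g)\<^sup>2 = 1 + (b g)\<^sup>2" for g
    by (auto simp: s_def add_pos_nonneg)
  \<comment> \<open>In a group with a single variable, \<open>t v\<close> is the standard deviation
    of the local part plus the noise; it is positive because
    \<open>\<bar>\<alpha>0 v\<bar> < 1\<close>.\<close>
  define t where "t v = sqrt (1 - (\<alpha>0 v)\<^sup>2)" for v
  have "(\<alpha>0 v)\<^sup>2 < 1" for v using range[of v] by (simp add: abs_square_less_1)
  then have t: "t v > 0" "(t v)\<^sup>2 = 1 - (\<alpha>0 v)\<^sup>2" for v
    by (auto simp: t_def less_imp_le)
  \<comment> \<open>\<open>\<beta>\<close> and \<open>\<gamma>\<close> are the coefficients of the
    global and the local variable in the new latent variable; \<open>\<delta>\<close> and
    \<open>\<rho>\<close> are those of the local variable and the old noise in the new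
    disturbance.\<close>
  define \<beta> where "\<beta> g = (if big g then b g / s g else 1)" for g
  define \<gamma> where "\<gamma> g = (if big g then 1 / s g else 0)" for g
  define \<delta> where "\<delta> v = (if big (grp v) then 0 else \<alpha> v / t v)" for v
  define \<rho> where "\<rho> v = (if big (grp v) then 1 else \<psi> v / t v)" for v
  have bg: "(\<beta> g)\<^sup>2 + (\<gamma> g)\<^sup>2 = 1" for g
    using s[of g] by (auto simp: \<beta>_def \<gamma>_def power_divide add_divide_distrib[symmetric] add.commute)
  have dr: "(\<delta> v)\<^sup>2 + (\<rho> v)\<^sup>2 = 1" for v
    using t[of v] psi[of v] by (auto simp: \<delta>_def \<rho>_def power_divide add_divide_distrib[symmetric])
  \<comment> \<open>In a big group the common part is
    \<open>\<alpha> v * (b g * W\<^sub>0 + W\<^sub>g)\<close>, that is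
    \<open>\<alpha> v * s g\<close> times the new latent variable; otherwise only the loading on
    \<open>W\<^sub>0\<close> remains.\<close>
  define \<theta> where "\<theta> = case_sum (\<lambda>v. if big (grp v) then \<alpha> v * s (grp v) else \<alpha>0 v) \<beta>"
  define \<psi>' where "\<psi>' v = (if big (grp v) then \<psi> v else t v)" for v
  define B :: "'g \<Rightarrow> 'g option + 'v \<Rightarrow> real"
    where "B g = case_sum (case_option (\<beta> g) (\<lambda>h. if h = g then \<gamma> g else 0)) (\<lambda>_. 0)" for g
  define C :: "'v \<Rightarrow> 'g option + 'v \<Rightarrow> real"
    where "C v = case_sum (case_option 0 (\<lambda>h. if h = grp v then \<delta> v else 0)) (\<lambda>u. if u = v then \<rho> v else 0)" for v
  \<comment> \<open>Latent combinations of distinct groups share only the global coordinate.\<close>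
  have BB: "(\<Sum>i\<in>UNIV. B g i * B h i) = (if g = h then 1 else \<beta> g * \<beta> h)" for g h
    using bg[of g] by (auto simp: sum_UNIV_option_sum B_def power2_eq_square if_distrib[of "\<lambda>x. x * _"] cong: if_cong)
  have CC: "(\<Sum>i\<in>UNIV. (C v i)\<^sup>2) = 1" for v
    using dr[of v] by (simp add: sum_UNIV_option_sum C_def if_distrib[of "\<lambda>x. x\<^sup>2"] cong: if_cong)
  have combB: "comb (B g) \<omega> = \<beta> g * F (Inl None) \<omega> + \<gamma> g * F (Inl (Some g)) \<omega>" for g \<omega>
    by (simp add: comb_def sum_UNIV_option_sum B_def if_distrib[of "\<lambda>x. x * _"] cong: if_cong)
  have combC: "comb (C v) \<omega> = \<delta> v * F (Inl (Some (grp v))) \<omega> + \<rho> v * F (Inr v) \<omega>" for v \<omega>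
    by (simp add: comb_def sum_UNIV_option_sum C_def if_distrib[of "\<lambda>x. x * _"] cong: if_cong)
  have small: "u = v" if "\<not> big (grp v)" "grp u = grp v" for u v
  proof (rule ccontr)
    assume "u \<noteq> v"
    then have "card {u, v} \<le> card (grp -` {grp v})" using that by (intro card_mono) auto
    with \<open>u \<noteq> v\<close> that show False by (simp add: big_def)
  qed
  \<comment> \<open>A local coordinate enters a disturbance only in a group that is not big, where
    no second variable can share it.\<close>
  have disjC: "u = v" if "C u i \<noteq> 0" "C v i \<noteq> 0" for u v i
  proof (cases i)
    case (Inl k)
    with that obtain g where "i = Inl (Some g)" by (cases k) (auto simp: C_def)
    with that have "\<not> big (grp v)" "grp u = grp v"
      by (simp_all add: C_def \<delta>_def split: if_splits)
    then show ?thesis by (rule small)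
  next
    case (Inr w)
    with that show ?thesis by (simp add: C_def split: if_splits)
  qed
  \<comment> \<open>Local coordinates enter \<open>B\<close> only for big groups and
    \<open>C\<close> only for the others; the global one never enters \<open>C\<close>.\<close>
  have disjBC: "C v i = 0" if "B g i \<noteq> 0" for g v i
    using that by (auto simp: B_def C_def \<gamma>_def \<delta>_def split: sum.splits option.splits if_splits)

  have "gaussian_oblique_model M grp (\<lambda>v. \<theta> (Inl v)) (oblique_correlations grp \<theta>) \<psi>' Y
      (\<lambda>\<omega>. \<chi> g. comb (B g) \<omega>) (\<lambda>\<omega>. \<chi> v. comb (C v) \<omega>)"
    unfolding gaussian_oblique_model_def
  proof (intro conjI allI)
    show "prob_space M" by (rule prob_space_axioms)
    show "surj grp" by fact
    show "multivariate_normal M (\<lambda>\<omega>. \<chi> g. comb (B g) \<omega>)" by (rule multivariate_normal_comb)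
    show E: "expectation (\<lambda>\<omega>. (\<chi> g. comb (B g) \<omega>) $ g) = 0" for g
      using expectation_comb[of "B g"] by simp
    show "variance (\<lambda>\<omega>. (\<chi> g. comb (B g) \<omega>) $ g) = 1" for g
      using expectation_comb_mult[of "B g" "B g"] unfolding E by (simp add: BB power2_eq_square)
    \<comment> \<open>The default 1 in \<open>oblique_correlations\<close> agrees with
      \<open>\<beta> g = 1\<close> for groups that are not big.\<close>
    show "expectation (\<lambda>\<omega>. (\<chi> g. comb (B g) \<omega>) $ g * (\<chi> g. comb (B g) \<omega>) $ h) =
        oblique_correlations grp \<theta> $ g $ h" for g h
      by (auto simp: expectation_comb_mult BB oblique_correlations_def oblique_parameters_def
          \<theta>_def \<beta>_def big_def Let_def)
    show "indep_vars (\<lambda>_. borel) (\<lambda>v \<omega>. (\<chi> v. comb (C v) \<omega>) $ v) UNIV"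
      using indep_vars_comb[of C UNIV] disjC by simp
    show "std_normal_var M (\<lambda>\<omega>. (\<chi> v. comb (C v) \<omega>) $ v)" for v
      using std_normal_comb[OF CC[of v]] by simp
    show "indep_set (sets (vimage_algebra (space M) (\<lambda>\<omega>. \<chi> g. comb (B g) \<omega>) borel))
      (sets (vimage_algebra (space M) (\<lambda>\<omega>. \<chi> v. comb (C v) \<omega>) borel))"
      by (rule indep_set_comb_vec) (rule disjBC)
    show "(\<psi>' v)\<^sup>2 = 1 - (\<theta> (Inl v))\<^sup>2" for v
      using psi[of v] t[of v] s[of "grp v"] b[of v]
      by (simp add: \<psi>'_def \<theta>_def power_mult_distrib algebra_simps)
    have "\<alpha>0 v * x + \<alpha> v * y + \<psi> v * z
        = \<theta> (Inl v) * (\<beta> (grp v) * x + \<gamma> (grp v) * y) + \<psi>' v * (\<delta> v * y + \<rho> v * z)" for v x y z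
      using s[of "grp v"] t[of v] b[of v]
      by (simp add: \<theta>_def \<beta>_def \<gamma>_def \<delta>_def \<rho>_def \<psi>'_def distrib_left)
    with Y show "AE \<omega> in M. \<forall>v. Y \<omega> $ v = \<theta> (Inl v) * (\<chi> g. comb (B g) \<omega>) $ grp v +
        \<psi>' v * (\<chi> v. comb (C v) \<omega>) $ v"
      by (simp add: combB combC)
  qed
  then show ?thesis by blast
qed

section \<open>Identifiability\<close>

text \<open>A nonzero kernel vector \<open>c\<close> gives an undetermined combination
  \<open>c \<bullet> W\<close>, whereas determining \<open>W\<close> would determine all its
  combinations.\<close>

lemma rank_deficient_not_identifiable:
  fixes A :: "real ^ 'p ^ 'd"
  assumes model: "gaussian_factor_model M A \<Psi> Z W \<epsilon>" and rank: "rank A \<noteq> CARD('p)"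
  shows "\<not> determined_by M W (noise_free_part \<Psi> Z \<epsilon>)"
    and "identified_combinations M \<Psi> Z W \<epsilon> \<noteq> UNIV"
proof -
  interpret prob_space M using model by (simp add: gaussian_factor_model_def)
  obtain c where c: "c \<noteq> 0" "A *v c = 0"
    using rank matrix_nonfull_linear_equations_eq by blast
  have "indep_vars (\<lambda>_. borel) (case_sum (\<lambda>k \<omega>. W \<omega> $ k) (\<lambda>j \<omega>. \<epsilon> \<omega> $ j)) UNIV"
    using model by (simp add: gaussian_factor_model_def)
  from indep_vars_reindex[OF this, of Inl UNIV]
  have "indep_vars (\<lambda>_. borel) (\<lambda>k \<omega>. W \<omega> $ k) UNIV"
    by (simp add: comp_def)
  then have nd: "\<not> determined_by M (\<lambda>\<omega>. c \<bullet> W \<omega>) (noise_free_part \<Psi> Z \<epsilon>)"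
    by (rule kernel_combination_not_determined[where A = A])
      (use model c in \<open>auto simp: gaussian_factor_model_def noise_free_part_def\<close>)
  then show "identified_combinations M \<Psi> Z W \<epsilon> \<noteq> UNIV"
    by (auto simp: identified_combinations_def)
  show "\<not> determined_by M W (noise_free_part \<Psi> Z \<epsilon>)"
  proof
    assume "determined_by M W (noise_free_part \<Psi> Z \<epsilon>)"
    then obtain h where [measurable]: "h \<in> borel_measurable borel"
      and "AE \<omega> in M. W \<omega> = h (noise_free_part \<Psi> Z \<epsilon> \<omega>)"
      by (auto simp: determined_by_def)
    then have "determined_by M (\<lambda>\<omega>. c \<bullet> W \<omega>) (noise_free_part \<Psi> Z \<epsilon>)"
      unfolding determined_by_def by (intro bexI[of _ "\<lambda>y. c \<bullet> h y"]) auto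
    with nd show False ..
  qed
qed

text \<open>A vector of the row space has the form \<open>transpose A *v x\<close>, and its product
  with \<open>W\<close> equals \<open>x \<bullet> (A *v W)\<close>, a continuous function of the
  noise-free part.\<close>

lemma span_rows_identified:
  assumes model: "gaussian_factor_model M A \<Psi> Z W \<epsilon>"
  shows "span (rows A) \<subseteq> identified_combinations M \<Psi> Z W \<epsilon>"
proof
  fix c assume "c \<in> span (rows A)"
  moreover have "span (rows A) \<subseteq> range (\<lambda>x. transpose A *v x)"
  proof (rule span_minimal)
    show "rows A \<subseteq> range (\<lambda>x. transpose A *v x)"
      by (auto simp: rows_def matrix_vector_mult_basis[symmetric] column_transpose[symmetric])
    show "subspace (range (\<lambda>x. transpose A *v x))"
      by (intro linear_subspace_image matrix_vector_mul_linear subspace_UNIV)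
  qed
  ultimately have "c \<in> range (\<lambda>x. transpose A *v x)" by blast
  then obtain x where c: "c = transpose A *v x" by blast
  have "c \<bullet> w = x \<bullet> (A *v w)" for w
    by (simp add: c dot_lmul_matrix)
  then have "determined_by M (\<lambda>\<omega>. c \<bullet> W \<omega>) (noise_free_part \<Psi> Z \<epsilon>)"
    unfolding determined_by_def
    using model by (intro bexI[of _ "\<lambda>y. x \<bullet> y"]) (auto simp: gaussian_factor_model_def noise_free_part_def)
  then show "c \<in> identified_combinations M \<Psi> Z W \<epsilon>"
    by (simp add: identified_combinations_def)
qed

text \<open>The two statements on identified combinations make precise that some, but not all, are
  identified. The condition on local columns keeps every local variable present in the model: a zero
  local column alone lowers the rank and says nothing about the global loadings. The oblique model
  keeps the same \<open>Y\<close> on the same probability space.\<close>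

theorem theorem1:
  fixes M :: "'a measure"
    and A :: "real ^ 'p ^ 'd" and \<Psi> :: "real ^ 'd ^ 'd"
    and Z :: "'a \<Rightarrow> real ^ 'd" and W :: "'a \<Rightarrow> real ^ 'p" and \<epsilon> :: "'a \<Rightarrow> real ^ 'd"
    and N :: "'b measure"
    and grp :: "'v::finite \<Rightarrow> 'g::finite" and \<alpha>0 \<alpha> \<psi> :: "'v \<Rightarrow> real"
    and Y :: "'b \<Rightarrow> real ^ 'v" and V :: "'b \<Rightarrow> real ^ 'g option" and \<eta> :: "'b \<Rightarrow> real ^ 'v"
  shows
    "(CARD('p) \<ge> 2 \<and> gaussian_factor_model M A \<Psi> Z W \<epsilon> \<and> rank A \<noteq> CARD('p) \<longrightarrow>
        \<not> determined_by M W (noise_free_part \<Psi> Z \<epsilon>) \<and>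
        span (rows A) \<subseteq> identified_combinations M \<Psi> Z W \<epsilon> \<and>
        identified_combinations M \<Psi> Z W \<epsilon> \<noteq> UNIV)
     \<and>
     (gaussian_bifactor_model N grp \<alpha>0 \<alpha> \<psi> Y V \<eta> \<and>
      (\<forall>g. column (Some g) (bifactor_loadings grp \<alpha>0 \<alpha>) \<noteq> 0) \<and>
      rank (bifactor_loadings grp \<alpha>0 \<alpha>) \<noteq> CARD('g option) \<longrightarrow>
        (\<exists>(\<theta> :: 'v + 'g \<Rightarrow> real) \<psi>' V' \<eta>'.
           gaussian_oblique_model N grp (\<lambda>v. \<theta> (Inl v)) (oblique_correlations grp \<theta>) \<psi>' Y V' \<eta>') \<and>
        card (oblique_parameters grp) < card (bifactor_parameters :: ('v + 'v) set))"
proof (intro conjI impI)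
  assume a: "CARD('p) \<ge> 2 \<and> gaussian_factor_model M A \<Psi> Z W \<epsilon> \<and> rank A \<noteq> CARD('p)"
  then show "\<not> determined_by M W (noise_free_part \<Psi> Z \<epsilon>)"
    and "identified_combinations M \<Psi> Z W \<epsilon> \<noteq> UNIV"
    using rank_deficient_not_identifiable[of M A \<Psi> Z W \<epsilon>] by auto
  show "span (rows A) \<subseteq> identified_combinations M \<Psi> Z W \<epsilon>"
    using a span_rows_identified by blast
next
  assume a: "gaussian_bifactor_model N grp \<alpha>0 \<alpha> \<psi> Y V \<eta> \<and>
      (\<forall>g. column (Some g) (bifactor_loadings grp \<alpha>0 \<alpha>) \<noteq> 0) \<and>
      rank (bifactor_loadings grp \<alpha>0 \<alpha>) \<noteq> CARD('g option)"
  obtain b where "\<And>v. \<alpha>0 v = b (grp v) * \<alpha> v"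
    by (rule rank_deficient_bifactor_loadings[of grp \<alpha>0 \<alpha>]) (use a in auto)
  from bifactor_imp_oblique[OF conjunct1[OF a] this] show "\<exists>(\<theta> :: 'v + 'g \<Rightarrow> real) \<psi>' V' \<eta>'.
      gaussian_oblique_model N grp (\<lambda>v. \<theta> (Inl v)) (oblique_correlations grp \<theta>) \<psi>' Y V' \<eta>'"
    .
qed (rule card_oblique_parameters_less)

end
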